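(* Let $H$ be a real symmetric matrix indexed by a finite set $V$, let $a,b\in V$ be distinct, and suppose that \[ \operatorname{supp}_H(e_a)\cup\operatorname{supp}_H(e_b)\subseteq c\mathbb Z\qquad\text{for some real } c>0. \] Then for every $k\in\mathbb N^+$: if $k$ is odd, $H^k$ has PST from $a$ to $b$ if and only if $H$ has PST from $a$ to $b$; if $k$ is even, $H^k$ has PST from $a$ to $b$ if and only if $H^2$ has PST from $a$ to $b$. Consequently, \[ \mathcal K(H;a,b)\in\{\varnothing,\ 2\mathbb N+1,\ 2\mathbb N^+,\ \mathbb N^+\}. \]
   Context: $\mathbb N=\{0,1,2,\ldots\}$ and $\mathbb N^+=\{1,2,3,\ldots\}$. For a finite set $V$, $e_v$ denotes the standard basis vector indexed by $v\in V$. For a real symmetric matrix $H$ indexed by $V$ with spectral decomposition $H=\sum_{\lambda\in\operatorname{Spec}(H)}\lambda E_\lambda$ ($E_\lambda$ the orthogonal projection onto the $\lambda$-eigenspace), and a vector $x$, put $\operatorname{supp}_H(x)=\{\lambda\in\operatorname{Spec}(H):E_\lambda x\neq 0\}$. A real symmetric matrix $K$ has perfect state transfer (PST) from $a$ to $b$ at time $\tau>0$ if $\exp(-\mathrm i\tau K)e_a=\gamma e_b$ for some $\gamma\in\mathbb C$ with $|\gamma|=1$; $K$ has PST from $a$ to $b$ if this holds for some $\tau>0$. $\mathcal K(H;a,b)=\{k\in\mathbb N^+: H^k\text{ has PST from }a\text{ to }b\}$. *)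

theory Defs
  imports "HOL-Analysis.Analysis"
begin

text \<open>
  The finite index set is the universe of a finite type. On \<open>'a ^ 'v ^ 'v\<close> the class
  operations \<open>(^)\<close>, \<open>(*)\<close> and \<open>1\<close> are componentwise, so powers with respect to the
  matrix product \<open>(**)\<close> need a separate function.
\<close>

primrec matpow :: "'a::semiring_1 ^ 'v ^ 'v \<Rightarrow> nat \<Rightarrow> 'a ^ 'v ^ 'v" where
  "matpow A 0 = mat 1"
| "matpow A (Suc n) = A ** matpow A n"

definition matexp :: "complex ^ 'v ^ 'v \<Rightarrow> complex ^ 'v ^ 'v" where
  "matexp A = (\<Sum>n. matpow A n /\<^sub>R fact n)"

definition symmetric_matrix :: "real ^ 'v ^ 'v \<Rightarrow> bool" where
  "symmetric_matrix H \<longleftrightarrow> transpose H = H"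

definition eigenspace :: "real ^ 'v ^ 'v \<Rightarrow> real \<Rightarrow> (real ^ 'v) set" where
  "eigenspace H \<mu> = {x. H *v x = \<mu> *\<^sub>R x}"

definition Spec :: "real ^ 'v ^ 'v \<Rightarrow> real set" where
  "Spec H = {\<mu>. \<exists>x. x \<noteq> 0 \<and> H *v x = \<mu> *\<^sub>R x}"

definition orth_proj :: "'a::euclidean_space set \<Rightarrow> 'a \<Rightarrow> 'a" where
  "orth_proj S x = (THE y. y \<in> S \<and> (\<forall>z\<in>S. orthogonal (x - y) z))"

definition eigenproj :: "real ^ 'v ^ 'v \<Rightarrow> real \<Rightarrow> real ^ 'v \<Rightarrow> real ^ 'v" where
  "eigenproj H \<mu> = orth_proj (eigenspace H \<mu>)"

definition eigsupp :: "real ^ 'v ^ 'v \<Rightarrow> real ^ 'v \<Rightarrow> real set" where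
  "eigsupp H x = {\<mu> \<in> Spec H. eigenproj H \<mu> x \<noteq> 0}"

text \<open>\<open>axis a 1\<close> is the standard basis vector at \<open>a\<close>; \<open>(*s)\<close> is multiplication by a complex scalar.\<close>

definition pst_at :: "real ^ 'v ^ 'v \<Rightarrow> 'v \<Rightarrow> 'v \<Rightarrow> real \<Rightarrow> bool" where
  "pst_at K a b \<tau> \<longleftrightarrow>
     (\<exists>\<gamma>::complex. cmod \<gamma> = 1 \<and>
        matexp (map_matrix (\<lambda>t. - (\<i> * of_real \<tau> * of_real t)) K) *v axis a 1 = \<gamma> *s axis b 1)"

definition has_pst :: "real ^ 'v ^ 'v \<Rightarrow> 'v \<Rightarrow> 'v \<Rightarrow> bool" where
  "has_pst K a b \<longleftrightarrow> (\<exists>\<tau>>0. pst_at K a b \<tau>)"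

definition pst_powers :: "real ^ 'v ^ 'v \<Rightarrow> 'v \<Rightarrow> 'v \<Rightarrow> nat set" where
  "pst_powers H a b = {k. 1 \<le> k \<and> has_pst (matpow H k) a b}"

text \<open>Well-definedness of the orthogonal projection and convergence of the exponential series.\<close>

lemma orth_proj_unique_existence:
  fixes S :: "'a::euclidean_space set"
  assumes "subspace S"
  shows "\<exists>!y. y \<in> S \<and> (\<forall>z\<in>S. orthogonal (x - y) z)"
proof -
  obtain y z where y: "y \<in> span S" and z: "\<And>w. w \<in> span S \<Longrightarrow> orthogonal z w" and "x = y + z"
    using orthogonal_subspace_decomp_exists by blast
  moreover have "span S = S"
    using assms by simp
  ultimately have "y \<in> S \<and> (\<forall>w\<in>S. orthogonal (x - y) w)"
    by auto
  moreover have "y' = y''"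
    if "y' \<in> S" "\<forall>z\<in>S. orthogonal (x - y') z" "y'' \<in> S" "\<forall>z\<in>S. orthogonal (x - y'') z" for y' y''
  proof -
    have "y' - y'' \<in> S"
      using that assms by (simp add: subspace_diff)
    then have "orthogonal (x - y'') (y' - y'')" "orthogonal (x - y') (y' - y'')"
      using that by auto
    then have "(y' - y'') \<bullet> (y' - y'') = 0"
      by (simp add: orthogonal_def inner_diff_left)
    then show ?thesis by simp
  qed
  ultimately show ?thesis by blast
qed

lemma subspace_eigenspace: "subspace (eigenspace H \<mu>)"
  by (auto simp: subspace_def eigenspace_def matrix_vector_right_distrib algebra_simps
      matrix_vector_mult_scaleR)

lemma summable_matexp:
  fixes A :: "complex ^ 'v ^ 'v"
  shows "summable (\<lambda>n. matpow A n /\<^sub>R fact n)"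
proof -
  define M where "M = (\<Sum>i\<in>UNIV. \<Sum>j\<in>UNIV. cmod (A $ i $ j))"
  define C where "C = real CARD('v)"
  have M: "cmod (A $ i $ j) \<le> M" for i j
  proof -
    have "cmod (A $ i $ j) \<le> (\<Sum>j\<in>UNIV. cmod (A $ i $ j))"
      by (rule member_le_sum) auto
    also have "\<dots> \<le> M"
      unfolding M_def by (rule member_le_sum[where f = "\<lambda>i. \<Sum>j\<in>UNIV. cmod (A $ i $ j)"])
        (auto intro: sum_nonneg)
    finally show ?thesis .
  qed
  have M0: "0 \<le> M" unfolding M_def by (intro sum_nonneg) auto
  have ent: "cmod (matpow A n $ i $ j) \<le> (C * M) ^ n" for n i j
  proof (induction n arbitrary: i j)
    case 0
    then show ?case by (simp add: mat_def)
  next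
    case (Suc n)
    have "cmod (matpow A (Suc n) $ i $ j) \<le> (\<Sum>k\<in>UNIV. cmod (A $ i $ k * matpow A n $ k $ j))"
      by (simp add: matrix_matrix_mult_def sum_norm_le)
    also have "\<dots> \<le> (\<Sum>k\<in>(UNIV::'v set). M * (C * M) ^ n)"
      using M Suc.IH M0 by (intro sum_mono) (auto simp: norm_mult intro!: mult_mono)
    also have "\<dots> = (C * M) ^ Suc n"
      by (simp add: C_def algebra_simps)
    finally show ?case .
  qed
  have nrm: "norm (matpow A n) \<le> C * C * (C * M) ^ n" for n
  proof -
    have "norm (matpow A n) \<le> (\<Sum>i\<in>UNIV. norm (matpow A n $ i))"
      unfolding norm_vec_def[of "matpow A n"] by (rule L2_set_le_sum) auto
    also have "\<dots> \<le> (\<Sum>i\<in>UNIV. \<Sum>j\<in>UNIV. cmod (matpow A n $ i $ j))"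
      by (rule sum_mono) (simp only: norm_vec_def, rule L2_set_le_sum, auto)
    also have "\<dots> \<le> (\<Sum>i\<in>(UNIV::'v set). \<Sum>j\<in>(UNIV::'v set). (C * M) ^ n)"
      by (intro sum_mono ent)
    also have "\<dots> = C * C * (C * M) ^ n"
      by (simp add: C_def)
    finally show ?thesis .
  qed
  show ?thesis
  proof (rule summable_comparison_test'[where N = 0])
    show "summable (\<lambda>n. C * C * ((C * M) ^ n /\<^sub>R fact n))"
      by (intro summable_mult summable_exp_generic)
    show "norm (matpow A n /\<^sub>R fact n) \<le> C * C * ((C * M) ^ n /\<^sub>R fact n)" for n
      using nrm[of n] by (simp add: divide_simps)
  qed
qed

end

theory Submission
  imports Defs
begin

text \<open>
  Since the eigenvectors \<open>z\<close> of \<open>H\<close> span the whole space, testing the transfer equation for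
  \<open>H\<^sup>k\<close> against them turns it into \<open>exp (-\<i> \<tau> \<mu>\<^sup>k) z\<^sub>a = \<gamma> z\<^sub>b\<close> for every eigenvalue \<open>\<mu>\<close> and every \<open>z\<close>
  in its eigenspace. As \<open>z\<close> is real, on each eigenspace \<open>z\<^sub>b = \<plusminus> z\<^sub>a\<close> with a sign depending only
  on \<open>\<mu>\<close>, and what remains is a condition on phases: for some \<open>\<tau> > 0\<close>, each \<open>\<tau> (\<mu>\<^sup>k - \<nu>\<^sup>k)\<close> is an
  integer multiple of \<open>\<pi>\<close>, even exactly when \<open>\<mu>\<close> and \<open>\<nu>\<close> have equal signs. Both signs occur
  because \<open>a \<noteq> b\<close>. Writing the eigenvalues in the support as \<open>c m\<close> with integers \<open>m\<close>, at least one of them odd,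
  this says that \<open>m\<^sup>k - n\<^sup>k\<close> has one fixed 2-adic valuation for opposite signs and a larger one for
  equal signs. If the \<open>m\<close> have both parities, then the valuation must be 0 and the condition only
  sees the parities, for every \<open>k\<close>. If all \<open>m\<close> are odd, then lifting the exponent shows that the
  valuation of \<open>m\<^sup>k - n\<^sup>k\<close> differs from that of \<open>m - n\<close> (\<open>k\<close> odd) or \<open>m\<^sup>2 - n\<^sup>2\<close> (\<open>k\<close> even) by a
  constant depending only on \<open>k\<close>.
\<close>

subsection \<open>Eigenvectors of a symmetric matrix\<close>

lemma dot_symmetric_matrix:
  fixes H :: "real ^ 'v ^ 'v"
  assumes "symmetric_matrix H"
  shows "x \<bullet> (H *v y) = (H *v x) \<bullet> y"
  using assms dot_lmul_matrix[of x H y] unfolding symmetric_matrix_def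
  by (metis transpose_matrix_vector)

lemma quadratic_nonneg_linear_coeff_zero:
  fixes p q :: real
  assumes "\<And>t. 0 \<le> t * p + t\<^sup>2 * q"
  shows "p = 0"
proof (rule ccontr)
  assume "p \<noteq> 0"
  \<comment> \<open>The sign is opposite to that of \<open>p\<close>; the added 1 keeps the
    denominator positive when \<open>q\<close> is 0 and makes the bound exactly - p^2 / (|q| +
    1)^2.\<close>
  define t where "t = - p / (\<bar>q\<bar> + 1)"
  have pos: "\<bar>q\<bar> + 1 > 0" by simp
  have "t * p + t\<^sup>2 * q \<le> t * p + t\<^sup>2 * \<bar>q\<bar>"
    by (simp add: mult_left_mono)
  also have "\<dots> = - (p\<^sup>2) / (\<bar>q\<bar> + 1)\<^sup>2"
    using pos unfolding t_def by (simp add: divide_simps power2_eq_square) algebra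
  also have "\<dots> < 0" using \<open>p \<noteq> 0\<close> pos by (simp add: divide_neg_pos)
  finally show False using assms[of t] by simp
qed

text \<open>By compactness the quadratic form of \<open>H\<close> attains a maximum on the unit
  sphere of \<open>S\<close>. At a maximizer the residual \<open>u\<close> vanishes, because a small
  move along \<open>u\<close> would otherwise increase the Rayleigh quotient.\<close>

lemma invariant_subspace_has_eigenvector:
  fixes H :: "real ^ 'v::finite ^ 'v"
  assumes sym: "symmetric_matrix H" and S: "subspace S"
    and inv: "\<And>x. x \<in> S \<Longrightarrow> H *v x \<in> S" and ne: "\<exists>x\<in>S. x \<noteq> 0"
  shows "\<exists>\<mu>. \<exists>x\<in>S. x \<noteq> 0 \<and> x \<in> eigenspace H \<mu>"
proof -
  define q where "q x = x \<bullet> (H *v x)" for x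
  let ?C = "sphere 0 1 \<inter> S"
  have "compact ?C"
    using S by (intro compact_Int_closed closed_subspace) auto
  moreover obtain w where "w \<in> S" "w \<noteq> 0" using ne by blast
  then have "(1 / norm w) *\<^sub>R w \<in> ?C"
    using S by (simp add: subspace_scale)
  then have "?C \<noteq> {}" by blast
  moreover have "continuous_on ?C q"
    unfolding q_def
    by (intro continuous_intros linear_continuous_on
        matrix_vector_mul_bounded_linear)
  ultimately obtain x where x: "x \<in> ?C" and max: "\<And>y. y \<in> ?C \<Longrightarrow> q y \<le> q x"
    using continuous_attains_sup[of ?C q] by blast
  have xS: "x \<in> S" and nx: "norm x = 1" using x by auto
  have bound: "q y \<le> q x * (y \<bullet> y)" if "y \<in> S" for y
  proof (cases "y = 0")
    case False
    have "q ((1 / norm y) *\<^sub>R y) \<le> q x"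
      using that False S by (intro max) (simp add: subspace_scale)
    then show ?thesis
      using False
      by (simp add: q_def matrix_vector_mult_scaleR dot_square_norm divide_simps
          power2_eq_square)
  qed (simp add: q_def)
  define u where "u = H *v x - q x *\<^sub>R x"
  have uS: "u \<in> S"
    unfolding u_def using S inv xS by (simp add: subspace_diff subspace_scale)
  have xx: "x \<bullet> x = 1" using nx by (simp add: dot_square_norm)
  \<comment> \<open>First-order optimality of \<open>x\<close> in the direction of the residual \<open>u\<close>, which lies in \<open>S\<close>.\<close>
  have "0 \<le> t * (- 2 * (u \<bullet> u)) + t\<^sup>2 * (q x * (u \<bullet> u) - q u)" for t
  proof -
    have "x + t *\<^sub>R u \<in> S" using xS uS S by (simp add: subspace_add subspace_scale)
    from bound[OF this]
    have le: "q (x + t *\<^sub>R u) \<le> q x * ((x + t *\<^sub>R u) \<bullet> (x + t *\<^sub>R u))" .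
    have qe: "q (x + t *\<^sub>R u) = q x + 2 * t * (u \<bullet> (H *v x)) + t\<^sup>2 * q u"
      using dot_symmetric_matrix[OF sym, of x u]
      by (simp add: q_def matrix_vector_right_distrib matrix_vector_mult_scaleR inner_add_left
          inner_add_right inner_commute power2_eq_square algebra_simps)
    have ne: "(x + t *\<^sub>R u) \<bullet> (x + t *\<^sub>R u) = 1 + 2 * t * (u \<bullet> x) + t\<^sup>2 * (u \<bullet> u)"
      using xx by (simp add: inner_add_left inner_add_right inner_commute power2_eq_square
          algebra_simps)
    have ue: "u \<bullet> u = u \<bullet> (H *v x) - q x * (u \<bullet> x)"
      by (subst (2) u_def) (simp add: inner_diff_right)
    have "t * (- 2 * (u \<bullet> u)) + t\<^sup>2 * (q x * (u \<bullet> u) - q u)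
        = q x * ((x + t *\<^sub>R u) \<bullet> (x + t *\<^sub>R u)) - q (x + t *\<^sub>R u)"
      unfolding qe ne by (subst (1) ue) (simp add: algebra_simps)
    then show ?thesis using le by simp
  qed
  then have "- 2 * (u \<bullet> u) = 0" by (rule quadratic_nonneg_linear_coeff_zero)
  then have "H *v x = q x *\<^sub>R x" by (simp add: u_def)
  moreover have "x \<noteq> 0" using nx by auto
  ultimately show ?thesis using xS unfolding eigenspace_def by blast
qed

text \<open>This is the spectral theorem in the form used below. By symmetry the common orthogonal
  complement of all eigenspaces is invariant; were it nonzero, it would contain an eigenvector,
  which would be orthogonal to itself.\<close>

lemma orthogonal_to_eigenvectors_eq_zero:
  fixes H :: "real ^ 'v::finite ^ 'v"
  assumes sym: "symmetric_matrix H"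
    and orth: "\<And>\<mu> z. z \<in> eigenspace H \<mu> \<Longrightarrow> z \<bullet> y = 0"
  shows "y = 0"
proof (rule ccontr)
  assume "y \<noteq> 0"
  define S where "S = {x. \<forall>\<mu>. \<forall>z\<in>eigenspace H \<mu>. z \<bullet> x = 0}"
  have "subspace S"
    by (auto simp: S_def subspace_def inner_add_right)
  moreover have "H *v x \<in> S" if "x \<in> S" for x
    using that unfolding S_def
    by (auto simp: dot_symmetric_matrix[OF sym]) (auto simp: eigenspace_def)
  moreover have "y \<in> S" using orth by (auto simp: S_def)
  ultimately obtain \<mu> x where x: "x \<in> S" "x \<noteq> 0" "x \<in> eigenspace H \<mu>"
    using invariant_subspace_has_eigenvector[OF sym] \<open>y \<noteq> 0\<close> by metis
  then have "x \<bullet> x = 0" unfolding S_def by blast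
  with x show False by simp
qed

text \<open>Replaces projections by inner products: a vector of the eigenspace pairs equally with
  \<open>x\<close> and with the projection of \<open>x\<close>, and the projection can be tested
  against itself.\<close>

lemma mem_eigsupp_iff:
  fixes H :: "real ^ 'v::finite ^ 'v"
  shows "\<mu> \<in> eigsupp H x \<longleftrightarrow> (\<exists>z\<in>eigenspace H \<mu>. z \<bullet> x \<noteq> 0)"
proof -
  let ?E = "eigenspace H \<mu>" and ?y = "eigenproj H \<mu> x"
  have "?y \<in> ?E \<and> (\<forall>z\<in>?E. orthogonal (x - ?y) z)"
    unfolding eigenproj_def orth_proj_def
    by (rule theI', rule orth_proj_unique_existence, rule subspace_eigenspace)
  then have yE: "?y \<in> ?E" and eq: "z \<bullet> x = z \<bullet> ?y" if "z \<in> ?E" for z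
    using that by (auto simp: orthogonal_def inner_diff_left inner_diff_right inner_commute)
  \<comment> \<open>\<open>yE\<close> carries a membership premise about an arbitrary vector; 0
    discharges it.\<close>
  have "0 \<in> ?E" by (simp add: eigenspace_def)
  then have y: "?y \<in> ?E" by (rule yE)
  have "?y \<noteq> 0 \<longleftrightarrow> (\<exists>z\<in>?E. z \<bullet> x \<noteq> 0)"
    using eq y by (metis inner_eq_zero_iff inner_zero_right)
  moreover have "?y \<noteq> 0 \<Longrightarrow> \<mu> \<in> Spec H"
    using y unfolding Spec_def eigenspace_def by blast
  ultimately show ?thesis unfolding eigsupp_def by blast
qed

section \<open>Matrix powers and exponentials tested against eigenvectors\<close>

lemma matpow_eigenvector:
  fixes H :: "real ^ 'v::finite ^ 'v"
  assumes "z \<in> eigenspace H \<mu>"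
  shows "matpow H k *v z = \<mu> ^ k *\<^sub>R z"
proof (induction k)
  case (Suc k)
  then show ?case
    using assms
    by (simp add: eigenspace_def matrix_vector_mul_assoc[symmetric] matrix_vector_mult_scaleR)
qed simp

lemma matrix_mult_matpow_commute:
  fixes H :: "'a::semiring_1 ^ 'v::finite ^ 'v"
  shows "H ** matpow H k = matpow H k ** H"
  by (induction k) (simp_all add: matrix_mul_assoc)

lemma symmetric_matpow:
  fixes H :: "real ^ 'v::finite ^ 'v"
  assumes "symmetric_matrix H"
  shows "symmetric_matrix (matpow H k)"
  using assms
  by (induction k)
    (simp_all add: symmetric_matrix_def transpose_mat matrix_transpose_mul matrix_mult_matpow_commute)

text \<open>Bilinear, with no complex conjugation of the second argument, so that a complex scalar
  in that argument comes out unchanged.\<close>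

definition rcdot :: "real ^ 'v \<Rightarrow> complex ^ 'v \<Rightarrow> complex" where
  "rcdot z w = (\<Sum>i\<in>UNIV. of_real (z $ i) * w $ i)"

lemma rcdot_axis: "rcdot z (axis a 1) = of_real (z $ a)"
  unfolding rcdot_def axis_def by (simp add: if_distrib cong: if_cong)

lemma rcdot_scale: "rcdot z (c *s w) = c * rcdot z w"
  unfolding rcdot_def by (simp add: sum_distrib_left mult.left_commute)

lemma rcdot_diff: "rcdot z (v - w) = rcdot z v - rcdot z w"
  unfolding rcdot_def by (simp add: sum_subtractf algebra_simps)

text \<open>Exchanging the two sums lets the symmetric matrix act on \<open>z\<close> instead of
  \<open>w\<close>.\<close>

lemma rcdot_left_eigenvector:
  fixes K :: "real ^ 'v::finite ^ 'v"
  assumes "symmetric_matrix K" and "K *v z = \<mu> *\<^sub>R z"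
  shows "rcdot z (map_matrix (\<lambda>t. s * of_real t) K *v w) = s * of_real \<mu> * rcdot z w"
proof -
  have sym: "K $ i $ j = K $ j $ i" for i j
    using assms(1) unfolding symmetric_matrix_def by (metis transpose_def vec_lambda_beta)
  have ev: "(\<Sum>i\<in>UNIV. K $ j $ i * z $ i) = \<mu> * z $ j" for j
    using arg_cong[OF assms(2), of "\<lambda>v. v $ j"] by (simp add: matrix_vector_mult_def)
  have "rcdot z (map_matrix (\<lambda>t. s * of_real t) K *v w)
      = (\<Sum>i\<in>UNIV. \<Sum>j\<in>UNIV. of_real (z $ i) * (s * of_real (K $ i $ j) * w $ j))"
    by (simp add: rcdot_def matrix_vector_mult_def map_matrix_def sum_distrib_left)
  also have "\<dots> = (\<Sum>j\<in>UNIV. \<Sum>i\<in>UNIV. of_real (z $ i) * (s * of_real (K $ i $ j) * w $ j))"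
    by (rule sum.swap)
  also have "\<dots> = (\<Sum>j\<in>UNIV. s * w $ j * of_real (\<Sum>i\<in>UNIV. K $ j $ i * z $ i))"
    by (simp add: sum_distrib_left sym mult_ac cong: sum.cong)
  also have "\<dots> = s * of_real \<mu> * rcdot z w"
    unfolding ev by (simp add: rcdot_def sum_distrib_left mult_ac)
  finally show ?thesis .
qed

text \<open>For fixed \<open>z\<close> and \<open>w\<close> the pairing is a bounded linear function
  of the matrix, so it passes through the exponential series and turns it into the scalar
  one.\<close>

lemma rcdot_matexp:
  fixes A :: "complex ^ 'v::finite ^ 'v"
  assumes "\<And>w. rcdot z (A *v w) = \<nu> * rcdot z w"
  shows "rcdot z (matexp A *v w) = exp \<nu> * rcdot z w"
proof -
  define F where "F M = rcdot z (M *v w)" for M :: "complex ^ 'v ^ 'v"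
  have "linear F"
    unfolding F_def rcdot_def matrix_vector_mult_def
    by (intro linearI)
      (simp_all add: algebra_simps sum.distrib sum_distrib_left scaleR_sum_right)
  then have bl: "bounded_linear F" by (simp add: linear_conv_bounded_linear)
  have pow: "F (matpow A n) = \<nu> ^ n * rcdot z w" for n
    unfolding F_def
    by (induction n) (simp_all add: matrix_vector_mul_assoc[symmetric] assms)
  have "F (matexp A) = (\<Sum>n. F (matpow A n /\<^sub>R fact n))"
    unfolding matexp_def by (rule bounded_linear.suminf[OF bl summable_matexp])
  also have "\<dots> = (\<Sum>n. (\<nu> ^ n /\<^sub>R fact n) * rcdot z w)"
    using \<open>linear F\<close> by (simp add: linear_scale pow)
  also have "\<dots> = exp \<nu> * rcdot z w"
    unfolding exp_def by (rule suminf_mult2[symmetric], rule summable_exp_generic)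
  finally show ?thesis by (simp add: F_def)
qed

lemma rcdot_eigenvectors_eq_zero:
  fixes H :: "real ^ 'v::finite ^ 'v"
  assumes "symmetric_matrix H"
    and "\<And>\<mu> z. z \<in> eigenspace H \<mu> \<Longrightarrow> rcdot z w = 0"
  shows "w = 0"
proof -
  have "z \<bullet> (\<chi> i. Re (w $ i)) = Re (rcdot z w)" "z \<bullet> (\<chi> i. Im (w $ i)) = Im (rcdot z w)" for z
    by (simp_all add: inner_vec_def rcdot_def)
  then have "(\<chi> i. Re (w $ i)) = 0" "(\<chi> i. Im (w $ i)) = 0"
    using assms(2) by (auto intro!: orthogonal_to_eigenvectors_eq_zero[OF assms(1)])
  then show ?thesis by (simp add: vec_eq_iff complex_eq_iff)
qed

lemma pst_at_matpow_iff:
  fixes H :: "real ^ 'v::finite ^ 'v"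
  assumes sym: "symmetric_matrix H"
  shows "pst_at (matpow H k) a b \<tau> \<longleftrightarrow>
    (\<exists>\<gamma>. cmod \<gamma> = 1 \<and> (\<forall>\<mu>. \<forall>z\<in>eigenspace H \<mu>.
       cis (- (\<tau> * \<mu> ^ k)) * of_real (z $ a) = \<gamma> * of_real (z $ b)))"
proof -
  define U where "U = matexp (map_matrix (\<lambda>t. - (\<i> * of_real \<tau> * of_real t)) (matpow H k))"
  have U: "rcdot z (U *v axis a 1) = cis (- (\<tau> * \<mu> ^ k)) * of_real (z $ a)"
    if z: "z \<in> eigenspace H \<mu>" for z \<mu>
  proof -
    have "rcdot z (map_matrix (\<lambda>t. - (\<i> * of_real \<tau> * of_real t)) (matpow H k) *v w)
        = - \<i> * of_real \<tau> * of_real (\<mu> ^ k) * rcdot z w" for w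
      using rcdot_left_eigenvector[OF symmetric_matpow[OF sym] matpow_eigenvector[OF z],
          where s = "- \<i> * of_real \<tau>"] by simp
    from rcdot_matexp[OF this] show ?thesis
      by (simp add: U_def rcdot_axis cis_conv_exp mult_ac)
  qed
  have "U *v axis a 1 = \<gamma> *s axis b 1 \<longleftrightarrow> (\<forall>\<mu>. \<forall>z\<in>eigenspace H \<mu>.
       cis (- (\<tau> * \<mu> ^ k)) * of_real (z $ a) = \<gamma> * of_real (z $ b))" (is "?l \<longleftrightarrow> ?r") for \<gamma>
  proof
    assume ?l
    then show ?r using U by (metis rcdot_axis rcdot_scale)
  next
    assume ?r
    then have "U *v axis a 1 - \<gamma> *s axis b 1 = 0"
      by (intro rcdot_eigenvectors_eq_zero[OF sym])
        (simp add: rcdot_diff rcdot_scale rcdot_axis U)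
    then show ?l by simp
  qed
  then show ?thesis unfolding pst_at_def U_def by simp
qed

subsection \<open>Phases and 2-adic valuations\<close>

lemma cis_eq_sign_iff:
  "cis \<theta> = (if P then 1 else - 1) \<longleftrightarrow> (\<exists>j::int. \<theta> = pi * of_int j \<and> (even j \<longleftrightarrow> P))"
proof -
  have one: "cis t = 1 \<longleftrightarrow> (\<exists>j::int. t = pi * of_int (2 * j))" for t
    by (simp add: cis_conv_exp exp_eq_1 mult_ac)
  show ?thesis
  proof (cases P)
    case True
    have "cis \<theta> = 1 \<longleftrightarrow> (\<exists>j::int. \<theta> = pi * of_int j \<and> even j)"
      unfolding one dvd_def by blast
    then show ?thesis using True by simp
  next
    case False
    have "cis (\<theta> - pi) = - cis \<theta>"
      by (simp flip: cis_divide)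
    then have "cis \<theta> = - 1 \<longleftrightarrow> cis (\<theta> - pi) = 1"
      by (metis minus_minus)
    also have "\<dots> \<longleftrightarrow> (\<exists>j::int. \<theta> = pi * of_int (2 * j + 1))"
      by (simp add: one algebra_simps)
    also have "\<dots> \<longleftrightarrow> (\<exists>j::int. \<theta> = pi * of_int j \<and> odd j)"
      by (metis add_diff_cancel_right' dvd_triv_left even_plus_one_iff oddE)
    finally show ?thesis using False by simp
  qed
qed

text \<open>For \<open>p\<close> taking both values on \<open>T\<close>: differences within a class are more 2-divisible than
  differences across the classes, and the latter all have the same 2-adic valuation \<open>r\<close>.\<close>

definition two_adic_split :: "'a set \<Rightarrow> ('a \<Rightarrow> bool) \<Rightarrow> ('a \<Rightarrow> int) \<Rightarrow> bool" where
  "two_adic_split T p g \<longleftrightarrow> (\<exists>r. \<forall>x\<in>T. \<forall>y\<in>T.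
     2 ^ r dvd g x - g y \<and> (2 ^ Suc r dvd g x - g y \<longleftrightarrow> (p x \<longleftrightarrow> p y)))"

text \<open>Quotients of the equations at two points eliminate \<open>\<gamma>\<close>; comparison
  with a fixed pair of opposite signs then eliminates \<open>\<tau>\<close>, leaving pure
  divisibility.\<close>

lemma phase_condition_iff:
  assumes xy: "x0 \<in> T" "y0 \<in> T" "p x0" "\<not> p y0"
  shows "(\<exists>\<tau>>0. \<exists>\<gamma>. cmod \<gamma> = 1 \<and>
            (\<forall>x\<in>T. cis (- (\<tau> * of_int (g x))) = \<gamma> * (if p x then 1 else - 1)))
     \<longleftrightarrow> two_adic_split T p g" (is "?lhs \<longleftrightarrow> _")
proof
  assume ?lhs
  then obtain \<tau> \<gamma> where \<tau>: "\<tau> > 0" and \<gamma>: "cmod \<gamma> = 1"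
    and eq: "\<And>x. x \<in> T \<Longrightarrow> cis (- (\<tau> * of_int (g x))) = \<gamma> * (if p x then 1 else - 1)"
    by blast
  have "\<gamma> \<noteq> 0" using \<gamma> by auto
  have ex: "\<exists>j::int. \<tau> * of_int (g x - g y) = pi * of_int j \<and> (even j \<longleftrightarrow> (p x \<longleftrightarrow> p y))"
    if "x \<in> T" "y \<in> T" for x y
  proof -
    have "\<tau> * of_int (g x - g y) = - (\<tau> * of_int (g y)) - (- (\<tau> * of_int (g x)))"
      by (simp add: algebra_simps)
    then have "cis (\<tau> * of_int (g x - g y)) = (if p x \<longleftrightarrow> p y then 1 else - 1)"
      using eq[OF that(1)] eq[OF that(2)] \<open>\<gamma> \<noteq> 0\<close>
      by (simp only: cis_divide[symmetric]) auto
    then show ?thesis by (simp only: cis_eq_sign_iff)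
  qed
  define d0 where "d0 = g x0 - g y0"
  obtain j0 where j0: "\<tau> * of_int d0 = pi * of_int j0" "odd j0"
    using ex[OF xy(1,2)] xy(3,4) unfolding d0_def by blast
  have "d0 \<noteq> 0" using j0 by auto
  define r where "r = multiplicity 2 d0"
  obtain u where u: "d0 = 2 ^ r * u" "odd u"
    using multiplicity_decompose'[of d0 2] \<open>d0 \<noteq> 0\<close> unfolding r_def by auto
  have "2 ^ r dvd g x - g y \<and> (2 ^ Suc r dvd g x - g y \<longleftrightarrow> (p x \<longleftrightarrow> p y))"
    if xyT: "x \<in> T" "y \<in> T" for x y
  proof -
    define d where "d = g x - g y"
    obtain j where j: "\<tau> * of_int d = pi * of_int j" "even j \<longleftrightarrow> (p x \<longleftrightarrow> p y)"
      using ex[OF xyT] unfolding d_def by blast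
    \<comment> \<open>Cross-multiplying with the reference pair cancels \<open>\<tau>\<close> and
      \<open>pi\<close>. Since \<open>j0\<close> and \<open>u\<close> are odd, the powers of 2
      dividing \<open>d\<close> are those dividing \<open>2 ^ r * j\<close>.\<close>
    have "\<tau> * pi * of_int (d * j0) = (\<tau> * of_int d) * (pi * of_int j0)" by simp
    also have "\<dots> = (pi * of_int j) * (\<tau> * of_int d0)" by (simp add: j j0)
    also have "\<dots> = \<tau> * pi * of_int (d0 * j)" by simp
    finally have dj: "d * j0 = 2 ^ r * (u * j)"
      using \<tau> u by (simp add: mult_ac flip: of_int_mult)
    have cop: "coprime (2 ^ n) j0" for n using j0(2) by simp
    have 1: "2 ^ r dvd d"
      using dj cop by (metis coprime_dvd_mult_left_iff dvd_triv_left)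
    have "2 ^ Suc r dvd d \<longleftrightarrow> 2 ^ Suc r dvd d * j0"
      using cop coprime_dvd_mult_left_iff by blast
    also have "\<dots> \<longleftrightarrow> even j"
      unfolding dj using u(2) by (simp add: mult.commute[of 2])
    finally show ?thesis using 1 j(2) unfolding d_def by blast
  qed
  then show "two_adic_split T p g" unfolding two_adic_split_def by blast
next
  assume "two_adic_split T p g"
  then obtain r where r: "\<And>x y. x \<in> T \<Longrightarrow> y \<in> T \<Longrightarrow>
     2 ^ r dvd g x - g y \<and> (2 ^ Suc r dvd g x - g y \<longleftrightarrow> (p x \<longleftrightarrow> p y))"
    unfolding two_adic_split_def by blast
  \<comment> \<open>With this time a difference \<open>2 ^ r * j\<close> gives the phase
    \<open>pi * j\<close>, whose sign is the parity of \<open>j\<close>. The witness for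
    \<open>\<gamma>\<close> is the phase at \<open>x0\<close>, where the sign is positive.\<close>
  define \<tau> where "\<tau> = pi / 2 ^ r"
  have "cis (- (\<tau> * of_int (g x))) = cis (- (\<tau> * of_int (g x0))) * (if p x then 1 else - 1)"
    if x: "x \<in> T" for x
  proof -
    obtain j where j: "g x0 - g x = 2 ^ r * j" using r[OF xy(1) x] by blast
    have "even j \<longleftrightarrow> (p x)"
      using r[OF xy(1) x] xy(3) unfolding j by (simp add: mult.commute[of 2])
    moreover have "\<tau> * of_int (g x0 - g x) = pi * of_int j"
      unfolding j \<tau>_def by simp
    ultimately have "cis (\<tau> * of_int (g x0 - g x)) = (if p x then 1 else - 1)"
      unfolding cis_eq_sign_iff by blast
    moreover have "- (\<tau> * of_int (g x)) = - (\<tau> * of_int (g x0)) + \<tau> * of_int (g x0 - g x)"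
      by (simp add: algebra_simps)
    ultimately show ?thesis by (simp only: cis_mult[symmetric])
  qed
  moreover have "\<tau> > 0" by (simp add: \<tau>_def)
  moreover have "cmod (cis (- (\<tau> * of_int (g x0)))) = 1" by simp
  ultimately show ?lhs
    by (intro exI[of _ \<tau>] exI[of _ "cis (- (\<tau> * of_int (g x0)))"] conjI ballI)
qed

section \<open>Lifting the exponent at the prime 2\<close>

lemma power_diff_odd_exponent:
  fixes m n :: int
  assumes "odd m" "odd n" "odd k"
  obtains u where "odd u" "m ^ k - n ^ k = (m - n) * u"
proof
  let ?u = "\<Sum>i<k. n ^ (k - Suc i) * m ^ i"
  show "m ^ k - n ^ k = (m - n) * ?u" by (rule power_diff_sumr2)
  \<comment> \<open>An odd number of summands, all of them odd.\<close>
  show "odd ?u" using assms by (simp add: even_sum_iff)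
qed

text \<open>Each doubling of the exponent contributes a sum of two odd squares, which is 2 modulo 4
  and so adds exactly one factor 2. The chain starts at exponent 2 because the valuation of
  \<open>m + n\<close> is not determined by oddness.\<close>

lemma power_diff_two_power_exponent:
  fixes m n :: int
  assumes "odd m" "odd n"
  obtains u where "odd u" "m ^ (2 * 2 ^ t) - n ^ (2 * 2 ^ t) = 2 ^ t * u * (m ^ 2 - n ^ 2)"
proof (induction t arbitrary: thesis)
  case 0
  show ?case by (rule 0[of 1]) auto
next
  case (Suc t)
  obtain u where u: "odd u" "m ^ (2 * 2 ^ t) - n ^ (2 * 2 ^ t) = 2 ^ t * u * (m ^ 2 - n ^ 2)"
    using Suc.IH by blast
  define M N where "M = m ^ (2 ^ t)" and "N = n ^ (2 ^ t)"
  have "odd M" "odd N" using assms by (auto simp: M_def N_def)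
  then obtain i j where ij: "M = 2 * i + 1" "N = 2 * j + 1" by (auto elim!: oddE)
  define v where "v = 2 * (i^2 + i + j^2 + j) + 1"
  have v: "M^2 + N^2 = 2 * v" unfolding ij v_def by (simp add: power2_eq_square algebra_simps)
  have e: "m ^ (2 * 2 ^ t) = M^2" "n ^ (2 * 2 ^ t) = N^2"
    by (simp_all add: M_def N_def power_mult[symmetric] mult.commute)
  have f: "m ^ (2 * 2 ^ Suc t) = (M^2)^2" "n ^ (2 * 2 ^ Suc t) = (N^2)^2"
    unfolding e[symmetric] by (simp_all add: power_mult[symmetric] mult.commute)
  have "m ^ (2 * 2 ^ Suc t) - n ^ (2 * 2 ^ Suc t) = (M^2 - N^2) * (M^2 + N^2)"
    unfolding f by (simp add: power2_eq_square algebra_simps)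
  also have "\<dots> = 2 ^ Suc t * (u * v) * (m ^ 2 - n ^ 2)"
    unfolding v using u(2) unfolding e by (simp add: mult_ac)
  finally show ?case
    using u(1) by (intro Suc.prems[of "u * v"]) (auto simp: v_def)
qed

text \<open>The shift \<open>t\<close> is 0 for odd \<open>k\<close> and the 2-adic valuation of
  \<open>k / 2\<close> for even \<open>k\<close>. Speaking of divisibility rather than valuations
  also covers \<open>m = n\<close>, where the valuation is infinite.\<close>

lemma two_power_dvd_power_diff:
  assumes "k \<ge> 1"
  obtains t :: nat where "\<And>(m::int) n s. odd m \<Longrightarrow> odd n \<Longrightarrow>
    2 ^ (s + t) dvd m ^ k - n ^ k \<longleftrightarrow> 2 ^ s dvd m ^ (if odd k then 1 else 2) - n ^ (if odd k then 1 else 2)"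
proof (cases "odd k")
  case True
  show thesis
  proof
    fix m n :: int and s :: nat assume "odd m" "odd n"
    then obtain u where "odd u" "m ^ k - n ^ k = (m - n) * u"
      using power_diff_odd_exponent True by blast
    then show "2 ^ (s + 0) dvd m ^ k - n ^ k \<longleftrightarrow>
        2 ^ s dvd m ^ (if odd k then 1 else 2) - n ^ (if odd k then 1 else 2)"
      using True by (simp add: coprime_dvd_mult_left_iff)
  qed
next
  case False
  obtain l where l: "k = 2 * l" "l \<noteq> 0" using False assms by (auto elim!: evenE)
  obtain w where w: "l = 2 ^ multiplicity 2 l * w" "odd w"
    using multiplicity_decompose'[of l 2] l(2) by auto
  define t where "t = multiplicity 2 l"
  have k: "k = (2 * 2 ^ t) * w" using w l unfolding t_def by simp
  show thesis
  proof
    fix m n :: int and s :: nat assume mn: "odd m" "odd n"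
    have "odd (m ^ (2 * 2 ^ t))" "odd (n ^ (2 * 2 ^ t))" using mn by auto
    then obtain u where u: "odd u" "m ^ k - n ^ k = (m ^ (2 * 2 ^ t) - n ^ (2 * 2 ^ t)) * u"
      using power_diff_odd_exponent[OF _ _ w(2)] unfolding k power_mult[of _ _ w] by blast
    obtain v where v: "odd v"
      "m ^ (2 * 2 ^ t) - n ^ (2 * 2 ^ t) = 2 ^ t * v * (m ^ 2 - n ^ 2)"
      using power_diff_two_power_exponent mn by blast
    have "m ^ k - n ^ k = 2 ^ t * ((m ^ 2 - n ^ 2) * (u * v))"
      unfolding u(2) v(2) by (simp add: mult_ac)
    then have "2 ^ (s + t) dvd m ^ k - n ^ k \<longleftrightarrow> 2 ^ s dvd (m ^ 2 - n ^ 2) * (u * v)"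
      by (simp add: power_add mult.commute[of "2 ^ s"])
    also have "\<dots> \<longleftrightarrow> 2 ^ s dvd m ^ 2 - n ^ 2"
      using u(1) v(1) by (intro coprime_dvd_mult_left_iff) simp
    finally show "2 ^ (s + t) dvd m ^ k - n ^ k \<longleftrightarrow>
        2 ^ s dvd m ^ (if odd k then 1 else 2) - n ^ (if odd k then 1 else 2)"
      using False by simp
  qed
qed

text \<open>A difference of an odd and an even power is odd, which forces \<open>r = 0\<close>;
  modulo 2 a positive power agrees with its base. The resulting criterion is free of
  \<open>k\<close>.\<close>

lemma two_adic_split_mixed_parity:
  assumes "k \<ge> 1" and x: "x \<in> T" "odd (f x)" and y: "y \<in> T" "even (f y)"
  shows "two_adic_split T p (\<lambda>x. f x ^ k) \<longleftrightarrow>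
    (\<forall>x\<in>T. \<forall>y\<in>T. even (f x - f y) \<longleftrightarrow> (p x \<longleftrightarrow> p y))"
proof -
  have "r = 0" if "\<forall>x\<in>T. \<forall>y\<in>T. 2 ^ r dvd f x ^ k - f y ^ k" for r
  proof (rule ccontr)
    assume "r \<noteq> 0"
    then have "2 dvd (2::int) ^ r" by simp
    then have "even (f x ^ k - f y ^ k)" using that x(1) y(1) dvd_trans by blast
    then show False using x(2) y(2) assms(1) by simp
  qed
  then have r0: "r = 0" if "\<forall>x\<in>T. \<forall>y\<in>T. 2 ^ r dvd f x ^ k - f y ^ k \<and>
      (2 ^ Suc r dvd f x ^ k - f y ^ k \<longleftrightarrow> (p x \<longleftrightarrow> p y))" for r
    using that by blast
  have "two_adic_split T p (\<lambda>x. f x ^ k) \<longleftrightarrow>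
    (\<forall>x\<in>T. \<forall>y\<in>T. 2 ^ 0 dvd f x ^ k - f y ^ k \<and>
       (2 ^ Suc 0 dvd f x ^ k - f y ^ k \<longleftrightarrow> (p x \<longleftrightarrow> p y)))" (is "_ \<longleftrightarrow> ?P 0")
  proof
    assume "two_adic_split T p (\<lambda>x. f x ^ k)"
    then obtain r where r: "?P r" unfolding two_adic_split_def ..
    show "?P 0" using r unfolding r0[OF r] .
  next
    assume "?P 0"
    then show "two_adic_split T p (\<lambda>x. f x ^ k)" unfolding two_adic_split_def ..
  qed
  then show ?thesis using assms(1) by simp
qed

lemma two_adic_split_power_parity:
  assumes k: "k \<ge> 1" and odd: "\<exists>x\<in>T. odd (f x)"
    and xy: "x0 \<in> T" "y0 \<in> T" "p x0" "\<not> p y0"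
  shows "two_adic_split T p (\<lambda>x. f x ^ k) \<longleftrightarrow>
    two_adic_split T p (\<lambda>x. f x ^ (if odd k then 1 else 2))"
proof (cases "\<forall>x\<in>T. odd (f x)")
  case False
  then obtain x y where "x \<in> T" "odd (f x)" "y \<in> T" "even (f y)" using odd by blast
  note mixed = two_adic_split_mixed_parity[where f = f and p = p, OF _ this]
  show ?thesis
    using mixed[OF k] mixed[of "if odd k then 1 else 2"] by (simp only:) simp
next
  case True
  let ?k = "if odd k then 1 else 2 :: nat"
  obtain t where t: "\<And>x y s. x \<in> T \<Longrightarrow> y \<in> T \<Longrightarrow>
      2 ^ (s + t) dvd f x ^ k - f y ^ k \<longleftrightarrow> 2 ^ s dvd f x ^ ?k - f y ^ ?k"
    using two_power_dvd_power_diff[OF k] True by metis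
  show ?thesis
  proof
    assume "two_adic_split T p (\<lambda>x. f x ^ k)"
    then obtain r where r: "\<And>x y. x \<in> T \<Longrightarrow> y \<in> T \<Longrightarrow> 2 ^ r dvd f x ^ k - f y ^ k \<and>
        (2 ^ Suc r dvd f x ^ k - f y ^ k \<longleftrightarrow> (p x \<longleftrightarrow> p y))"
      unfolding two_adic_split_def by blast
    \<comment> \<open>Ensures that \<open>r - t\<close> is a true difference. Taking
      \<open>s = 0\<close> shows that \<open>2 ^ t\<close> divides every difference, whereas
      \<open>2 ^ Suc r\<close> does not divide the one for the opposite signs of \<open>x0\<close>
      and \<open>y0\<close>.\<close>
    have "t \<le> r"
    proof (rule ccontr)
      assume "\<not> t \<le> r"
      then have "(2::int) ^ Suc r dvd 2 ^ (0 + t)" by (intro le_imp_power_dvd) simp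
      also have "2 ^ (0 + t) dvd f x0 ^ k - f y0 ^ k"
        using t[of x0 y0 0] xy by simp
      finally show False using r[of x0 y0] xy by blast
    qed
    then have "r = (r - t) + t" "Suc r = Suc (r - t) + t" by simp_all
    then show "two_adic_split T p (\<lambda>x. f x ^ ?k)"
      unfolding two_adic_split_def using r t by metis
  next
    assume "two_adic_split T p (\<lambda>x. f x ^ ?k)"
    then show "two_adic_split T p (\<lambda>x. f x ^ k)"
      unfolding two_adic_split_def using t by (metis add_Suc)
  qed
qed

text \<open>Powers of 2 common to all the multiples are absorbed into \<open>c'\<close>.\<close>

lemma integer_multiples_some_odd:
  fixes T :: "real set"
  assumes "c > 0" "T \<subseteq> {c * of_int m | m. True}" "c * of_int m0 \<in> T" "m0 \<noteq> 0"
  shows "\<exists>c' f. c' > 0 \<and> (\<forall>x\<in>T. x = c' * of_int (f x)) \<and> (\<exists>x\<in>T. odd (f x :: int))"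
  using assms
proof (induction "nat \<bar>m0\<bar>" arbitrary: c m0 rule: less_induct)
  case less
  obtain f where f: "\<And>x. x \<in> T \<Longrightarrow> x = c * of_int (f x)"
    using less.prems(2) by (simp add: subset_iff) metis
  show ?case
  proof (cases "\<exists>x\<in>T. odd (f x)")
    case True
    then show ?thesis using f less.prems(1) by blast
  next
    case False
    \<comment> \<open>As all values of \<open>f\<close> are even in this case, so is
      \<open>m0\<close>; doubling \<open>c\<close> halves it, and a nonzero \<open>m0\<close>
      strictly decreases in absolute value.\<close>
    have "f (c * of_int m0) = m0" using f[OF less.prems(3)] less.prems(1) by simp
    then obtain m where m: "m0 = 2 * m" using False less.prems(3) by (metis evenE)
    show ?thesis
    proof (rule less.hyps)
      show "nat \<bar>m\<bar> < nat \<bar>m0\<bar>" "m \<noteq> 0" using m less.prems(4) by auto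
      show "2 * c > 0" using less.prems(1) by simp
      show "2 * c * of_int m \<in> T" using less.prems(3) m by (simp add: mult_ac)
      show "T \<subseteq> {2 * c * of_int m | m. True}"
      proof
        fix x assume x: "x \<in> T"
        then obtain i where "f x = 2 * i" using False by blast
        then have "x = 2 * c * of_int i" using f[OF x] by simp
        then show "x \<in> {2 * c * of_int m | m. True}" by blast
      qed
    qed
  qed
qed

subsection \<open>Perfect state transfer of powers\<close>

text \<open>A vector of \<open>E\<close> with nonzero entry at \<open>a\<close> fixes w / \<gamma>
  as a real number of modulus 1, hence as a sign common to all of \<open>E\<close>. If all entries
  at \<open>a\<close> and \<open>b\<close> vanish, both \<open>p\<close> and \<open>n\<close> hold
  and the phase is unconstrained, which explains the implication.\<close>

lemma unit_ratio_iff_sign: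
  fixes E :: "(real ^ 'v::finite) set" and a b :: 'v and w \<gamma> :: complex
  assumes "cmod w = 1" "cmod \<gamma> = 1"
  defines "p \<equiv> \<forall>z\<in>E. z $ b = z $ a" and "n \<equiv> \<forall>z\<in>E. z $ b = - z $ a"
  shows "(\<forall>z\<in>E. w * of_real (z $ a) = \<gamma> * of_real (z $ b)) \<longleftrightarrow>
    (p \<or> n) \<and> ((\<exists>z\<in>E. z $ a \<noteq> 0 \<or> z $ b \<noteq> 0) \<longrightarrow> w = \<gamma> * (if p then 1 else - 1))"
    (is "?l \<longleftrightarrow> ?r")
proof
  assume l: ?l
  have "\<gamma> \<noteq> 0" "w \<noteq> 0" using assms by auto
  show ?r
  proof (cases "\<forall>z\<in>E. z $ a = 0")
    case True
    then have "\<forall>z\<in>E. z $ b = 0" using l \<open>\<gamma> \<noteq> 0\<close> by auto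
    with True show ?thesis by (auto simp: p_def)
  next
    case False
    then obtain z0 where z0: "z0 \<in> E" "z0 $ a \<noteq> 0" by blast
    define q where "q = z0 $ b / z0 $ a"
    have w: "w = \<gamma> * of_real q"
      using l z0 by (simp add: q_def field_simps)
    then have "\<bar>q\<bar> = 1" using assms by (simp add: norm_mult)
    then consider "q = 1" | "q = - 1" by linarith
    then show ?thesis
    proof cases
      case 1
      then show ?thesis using l w \<open>\<gamma> \<noteq> 0\<close> by (auto simp: p_def)
    next
      case 2
      then have "\<not> p" using z0 by (auto simp: p_def q_def intro!: bexI[of _ z0])
      moreover have "z $ b = - z $ a" if "z \<in> E" for z
      proof -
        have "\<gamma> * of_real (z $ b) = \<gamma> * of_real (- z $ a)"
          using l that w 2 by auto
        then show ?thesis using \<open>\<gamma> \<noteq> 0\<close> by (simp del: of_real_minus)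
      qed
      then have n by (simp add: n_def)
      ultimately show ?thesis using w 2 by simp
    qed
  qed
next
  assume ?r
  then show ?l unfolding p_def n_def by (cases p; fastforce simp: p_def)
qed

text \<open>Separates the sign pattern of the eigenspaces, which is independent of \<open>k\<close>
  and of the time, from the phase condition on the support.\<close>

lemma has_pst_matpow_iff:
  fixes H :: "real ^ 'v::finite ^ 'v" and a b :: 'v
  assumes sym: "symmetric_matrix H"
  defines "p \<equiv> \<lambda>\<mu>. \<forall>z\<in>eigenspace H \<mu>. z $ b = z $ a"
    and "n \<equiv> \<lambda>\<mu>. \<forall>z\<in>eigenspace H \<mu>. z $ b = - z $ a"
    and "T \<equiv> eigsupp H (axis a 1) \<union> eigsupp H (axis b 1)"
  shows "has_pst (matpow H k) a b \<longleftrightarrow> (\<forall>\<mu>. p \<mu> \<or> n \<mu>) \<and>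
    (\<exists>\<tau>>0. \<exists>\<gamma>. cmod \<gamma> = 1 \<and> (\<forall>\<mu>\<in>T. cis (- (\<tau> * \<mu> ^ k)) = \<gamma> * (if p \<mu> then 1 else - 1)))"
proof -
  have T: "\<mu> \<in> T \<longleftrightarrow> (\<exists>z\<in>eigenspace H \<mu>. z $ a \<noteq> 0 \<or> z $ b \<noteq> 0)" for \<mu>
    unfolding T_def by (auto simp: mem_eigsupp_iff inner_axis)
  have "(\<forall>z\<in>eigenspace H \<mu>. cis (- (\<tau> * \<mu> ^ k)) * of_real (z $ a) = \<gamma> * of_real (z $ b)) \<longleftrightarrow>
      (p \<mu> \<or> n \<mu>) \<and> (\<mu> \<in> T \<longrightarrow> cis (- (\<tau> * \<mu> ^ k)) = \<gamma> * (if p \<mu> then 1 else - 1))"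
    if "cmod \<gamma> = 1" for \<mu> \<tau> \<gamma>
    unfolding T p_def n_def by (rule unit_ratio_iff_sign) (use that in auto)
  then have "(\<forall>\<mu>. \<forall>z\<in>eigenspace H \<mu>. cis (- (\<tau> * \<mu> ^ k)) * of_real (z $ a) = \<gamma> * of_real (z $ b))
      \<longleftrightarrow> (\<forall>\<mu>. p \<mu> \<or> n \<mu>) \<and>
        (\<forall>\<mu>\<in>T. cis (- (\<tau> * \<mu> ^ k)) = \<gamma> * (if p \<mu> then 1 else - 1))"
    if "cmod \<gamma> = 1" for \<tau> \<gamma>
    using that by (simp only: all_conj_distrib Ball_def[of T])
  note equations = this
  have "pst_at (matpow H k) a b \<tau> \<longleftrightarrow> (\<forall>\<mu>. p \<mu> \<or> n \<mu>) \<and>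
      (\<exists>\<gamma>. cmod \<gamma> = 1 \<and> (\<forall>\<mu>\<in>T. cis (- (\<tau> * \<mu> ^ k)) = \<gamma> * (if p \<mu> then 1 else - 1)))"
    for \<tau>
    unfolding pst_at_matpow_iff[OF sym] by (simp add: equations cong: conj_cong) blast
  then show ?thesis
    unfolding has_pst_def by blast
qed

text \<open>For distinct \<open>a\<close> and \<open>b\<close> the sum and the difference of their
  basis vectors are nonzero, so each has nonzero pairing with some eigenvector. The sum excludes
  \<open>n\<close> for one eigenvalue, the difference excludes \<open>p\<close> for another.\<close>

lemma eigsupp_both_signs:
  fixes H :: "real ^ 'v::finite ^ 'v" and a b :: 'v
  assumes sym: "symmetric_matrix H" and "a \<noteq> b"
  defines "p \<equiv> \<lambda>\<mu>. \<forall>z\<in>eigenspace H \<mu>. z $ b = z $ a"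
    and "n \<equiv> \<lambda>\<mu>. \<forall>z\<in>eigenspace H \<mu>. z $ b = - z $ a"
    and "T \<equiv> eigsupp H (axis a 1) \<union> eigsupp H (axis b 1)"
  assumes pn: "\<And>\<mu>. p \<mu> \<or> n \<mu>"
  obtains \<mu> \<nu> where "\<mu> \<in> T" "\<nu> \<in> T" "p \<mu>" "\<not> p \<nu>"
proof -
  have T: "\<mu> \<in> T \<longleftrightarrow> (\<exists>z\<in>eigenspace H \<mu>. z $ a \<noteq> 0 \<or> z $ b \<noteq> 0)" for \<mu>
    unfolding T_def by (auto simp: mem_eigsupp_iff inner_axis)
  have ax: "axis a 1 + s *\<^sub>R axis b (1::real) \<noteq> 0" for s
    using \<open>a \<noteq> b\<close> by (auto simp: vec_eq_iff axis_def intro!: exI[of _ a])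
  have ne: "\<exists>\<mu>. \<exists>z\<in>eigenspace H \<mu>. z $ a + s * z $ b \<noteq> 0" for s
    using orthogonal_to_eigenvectors_eq_zero[OF sym, of "axis a 1 + s *\<^sub>R axis b 1"] ax[of s]
    by (auto simp: inner_add_right inner_axis)
  obtain \<nu> z where \<nu>: "z \<in> eigenspace H \<nu>" "z $ a + (- 1) * z $ b \<noteq> 0" using ne by blast
  obtain \<mu> y where \<mu>: "y \<in> eigenspace H \<mu>" "y $ a + 1 * y $ b \<noteq> 0" using ne by blast
  have "\<not> n \<mu>" using \<mu> by (auto simp: n_def intro!: bexI[of _ y])
  then have "p \<mu>" using pn by blast
  moreover have "\<not> p \<nu>" using \<nu> by (auto simp: p_def intro!: bexI[of _ z])
  moreover have "\<nu> \<in> T" "\<mu> \<in> T" using \<mu> \<nu> unfolding T by force+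
  ultimately show thesis using that by blast
qed

lemma has_pst_matpow_parity:
  fixes H :: "real ^ 'v::finite ^ 'v"
  assumes sym: "symmetric_matrix H" and "a \<noteq> b"
    and c: "c > 0" "eigsupp H (axis a 1) \<union> eigsupp H (axis b 1) \<subseteq> {c * of_int m | m. True}"
    and k: "k \<ge> 1"
  shows "has_pst (matpow H k) a b \<longleftrightarrow> has_pst (matpow H (if odd k then 1 else 2)) a b"
proof -
  define p where "p \<mu> \<longleftrightarrow> (\<forall>z\<in>eigenspace H \<mu>. z $ b = z $ a)" for \<mu>
  define n where "n \<mu> \<longleftrightarrow> (\<forall>z\<in>eigenspace H \<mu>. z $ b = - z $ a)" for \<mu>
  define T where "T = eigsupp H (axis a 1) \<union> eigsupp H (axis b 1)"
  note pst = has_pst_matpow_iff[OF sym, of _ a b, folded p_def n_def T_def]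
  show ?thesis
  proof (cases "\<forall>\<mu>. p \<mu> \<or> n \<mu>")
    case False
    then show ?thesis unfolding pst by blast
  next
    case True
    then obtain \<mu> \<nu> where \<mu>\<nu>: "\<mu> \<in> T" "\<nu> \<in> T" "p \<mu>" "\<not> p \<nu>"
      using eigsupp_both_signs[OF sym \<open>a \<noteq> b\<close>, folded p_def n_def T_def] by blast
    have T: "T \<subseteq> {c * of_int m | m. True}" using c(2) unfolding T_def .
    \<comment> \<open>Eigenvalues of opposite signs are distinct, so they are not both 0.\<close>
    have "\<exists>\<kappa>\<in>T. \<kappa> \<noteq> 0" using \<mu>\<nu> by metis
    then obtain m0 where "c * of_int m0 \<in> T" "m0 \<noteq> 0" using T by fastforce
    from integer_multiples_some_odd[OF c(1) T this]
    obtain c' f where c': "c' > 0" and f: "\<And>x. x \<in> T \<Longrightarrow> x = c' * of_int (f x)"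
      and odd: "\<exists>x\<in>T. odd (f x :: int)" by blast
    have "has_pst (matpow H l) a b \<longleftrightarrow> two_adic_split T p (\<lambda>x. f x ^ l)" for l
    proof -
      let ?R = "\<lambda>\<tau> \<gamma>. cmod \<gamma> = 1 \<and>
        (\<forall>x\<in>T. cis (- (\<tau> * of_int (f x ^ l))) = \<gamma> * (if p x then 1 else - 1))"
      have eq: "\<tau> * x ^ l = (\<tau> * c' ^ l) * of_int (f x ^ l)" if "x \<in> T" for x \<tau>
        by (subst f[OF that]) (simp add: power_mult_distrib)
      have "has_pst (matpow H l) a b \<longleftrightarrow> (\<exists>\<tau>>0. \<exists>\<gamma>. ?R (\<tau> * c' ^ l) \<gamma>)"
        unfolding pst using True by (simp add: eq cong: ball_cong_simp)
      \<comment> \<open>The positive factor \<open>c' ^ l\<close> is absorbed by rescaling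
        time.\<close>
      also have "\<dots> \<longleftrightarrow> (\<exists>\<tau>>0. \<exists>\<gamma>. ?R \<tau> \<gamma>)"
      proof
        assume "\<exists>\<tau>>0. \<exists>\<gamma>. ?R (\<tau> * c' ^ l) \<gamma>"
        then show "\<exists>\<tau>>0. \<exists>\<gamma>. ?R \<tau> \<gamma>" using c' by (meson mult_pos_pos zero_less_power)
      next
        assume "\<exists>\<tau>>0. \<exists>\<gamma>. ?R \<tau> \<gamma>"
        then obtain \<tau> \<gamma> where "\<tau> > 0" "?R \<tau> \<gamma>" by blast
        moreover have "\<tau> / c' ^ l * c' ^ l = \<tau>" using c' by simp
        ultimately have "\<tau> / c' ^ l > 0" "?R (\<tau> / c' ^ l * c' ^ l) \<gamma>" using c' by simp_all
        then show "\<exists>\<tau>>0. \<exists>\<gamma>. ?R (\<tau> * c' ^ l) \<gamma>" by blast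
      qed
      also have "\<dots> \<longleftrightarrow> two_adic_split T p (\<lambda>x. f x ^ l)"
        by (rule phase_condition_iff[OF \<mu>\<nu>])
      finally show ?thesis .
    qed
    then show ?thesis using two_adic_split_power_parity[where p = p, OF k odd \<mu>\<nu>] by simp
  qed
qed

theorem theorem1p1:
  fixes H :: "real ^ 'v ^ 'v" and a b :: "'v::finite"
  assumes "symmetric_matrix H"
    and "a \<noteq> b"
    and "\<exists>c::real. c > 0 \<and> eigsupp H (axis a 1) \<union> eigsupp H (axis b 1) \<subseteq> {c * of_int m | m. True}"
  shows "(\<forall>k\<ge>1. (odd k \<longrightarrow> (has_pst (matpow H k) a b \<longleftrightarrow> has_pst H a b)) \<and>
                  (even k \<longrightarrow> (has_pst (matpow H k) a b \<longleftrightarrow> has_pst (matpow H 2) a b))) \<and>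
         pst_powers H a b \<in> {{}, {2 * n + 1 | n. True}, {2 * n | n. n \<ge> 1}, {n. n \<ge> 1}}"
proof
  obtain c where c: "c > 0"
    "eigsupp H (axis a 1) \<union> eigsupp H (axis b 1) \<subseteq> {c * of_int m | m. True}"
    using assms(3) by blast
  define P where "P \<longleftrightarrow> has_pst H a b"
  define Q where "Q \<longleftrightarrow> has_pst (matpow H 2) a b"
  have "matpow H 1 = H" by simp
  then have parity: "has_pst (matpow H k) a b \<longleftrightarrow> (if odd k then P else Q)" if "k \<ge> 1" for k
    using has_pst_matpow_parity[OF assms(1,2) c that] unfolding P_def Q_def
    by (simp only: if_distrib[of "matpow H"] if_distrib[of "\<lambda>K. has_pst K a b"])
  show "\<forall>k\<ge>1. (odd k \<longrightarrow> (has_pst (matpow H k) a b \<longleftrightarrow> has_pst H a b)) \<and>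
      (even k \<longrightarrow> (has_pst (matpow H k) a b \<longleftrightarrow> has_pst (matpow H 2) a b))"
    unfolding P_def[symmetric] Q_def[symmetric] by (simp add: parity)
  have "pst_powers H a b = {k. 1 \<le> k \<and> (if odd k then P else Q)}"
    unfolding pst_powers_def by (simp only: parity cong: conj_cong)
  \<comment> \<open>The four truth assignments to \<open>P\<close> and \<open>Q\<close> yield the
    four possible sets.\<close>
  also have "\<dots> = (if P then {k. 1 \<le> k \<and> odd k} else {}) \<union> (if Q then {k. 1 \<le> k \<and> even k} else {})"
    by auto
  finally have K: "pst_powers H a b = \<dots>" .
  have odds: "{k. 1 \<le> k \<and> odd k} = {2 * n + 1 | n::nat. True}"
    by (auto elim!: oddE)
  have evens: "{k. 1 \<le> k \<and> even k} = {2 * n | n::nat. n \<ge> 1}"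
    by (auto elim!: evenE)
  have naturals: "{k::nat. 1 \<le> k \<and> odd k} \<union> {k. 1 \<le> k \<and> even k} = {k. 1 \<le> k}"
    by auto
  show "pst_powers H a b \<in> {{}, {2 * n + 1 | n. True}, {2 * n | n. n \<ge> 1}, {n. n \<ge> 1}}"
    unfolding K odds[symmetric] evens[symmetric] naturals[symmetric]
    by (simp only: insert_iff Un_empty_left Un_empty_right simp_thms split: if_split)
qed

end
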